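(* For every integer $n\geq 1$, the boolean algebra $\mathcal{B}_n=(\mathcal{P}(\omega^n)/I_{\omega^n},\cap,\cup,\neg,\mathbf{0},\mathbf{1})$ is $\omega^n$-automatic.
   Context: $I_{\omega^n}=\{P\subseteq\omega^n\mid \mathrm{o.t.}(P)<\omega^n\}$, where $\mathrm{o.t.}(P)$ is the order type of $P$ as a suborder of $(\omega^n,<)$; it is an ideal of $\mathcal{P}(\omega^n)$. $\mathcal{P}(\omega^n)/I_{\omega^n}$ is the quotient by the equivalence $A\approx_n B$ iff $A\triangle B\in I_{\omega^n}$, with $[A]\cap[B]=[A\cap B]$, $[A]\cup[B]=[A\cup B]$, $\neg[A]=[\omega^n\setminus A]$, $\mathbf{0}=[\emptyset]$, $\mathbf{1}=[\omega^n]$. An ordinal Büchi automaton is a tuple $(\Sigma,Q,q_0,\Delta,\gamma,F)$ (finite alphabet, finite states, initial state, successor transitions $\Delta\subseteq Q\times\Sigma\times Q$, limit transitions $\gamma\subseteq\mathcal{P}(Q)\times Q$, final states); a run on a word of length $\alpha$ starts in $q_0$, follows $\Delta$ at successor steps, and at limit $i$ satisfies $(\mathrm{Inf}(x,i),x(i))\in\gamma$ where $\mathrm{Inf}(x,i)$ is the set of states appearing cofinally below $i$; acceptance means some run ends in $F$. An $\omega^n$-automaton reads words of length $\omega^n$; relations are read as languages over product alphabets and operations are replaced by their graphs. A relational structure $\mathcal{M}=(M,(R_i)_{i\le k})$ is $\omega^n$-automatic if there are $\omega^n$-automata $\mathcal{A},\mathcal{A}_=,\mathcal{A}_1,\dots,\mathcal{A}_k$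 and a surjection $h:L(\mathcal{A})\to M$ such that $\mathcal{A}_=$ accepts an equivalence relation $E$ on $L(\mathcal{A})$, each $\mathcal{A}_i$ accepts a relation $R_i'$ on $L(\mathcal{A})$ of the arity of $R_i$ compatible with $E$, and $h$ induces an isomorphism $(L(\mathcal{A}),(R_i'))/E\cong\mathcal{M}$. *)

theory Defs
  imports "HOL-Library.Multiset_Order" "HOL-Library.FuncSet"
begin

unbundle cardinal_syntax

section \<open>The ordinals \<open>\<omega>\<^sup>n\<close>\<close>

text \<open>
  The well-order \<^typ>\<open>nat multiset\<close> has order type \<open>\<omega>\<^sup>\<omega>\<close>: a multiset \<open>M\<close> is the Cantor normal
  form in which \<open>\<omega>\<^sup>k\<close> has coefficient \<open>count M k\<close>. As usual, an ordinal is identified with the set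
  of its predecessors. The lemmas below state that \<open>\<omega>\<^sup>0\<close> has exactly one predecessor and that
  \<open>\<omega>\<^bsup>n+1\<^esup>\<close> is the lexicographic product of \<open>\<omega>\<close> copies of \<open>\<omega>\<^sup>n\<close>.
\<close>

definition omega_pow :: "nat \<Rightarrow> nat multiset" where
  "omega_pow n = {#n#}"

lemma lessThan_omega_pow_0: "{..<omega_pow 0} = {{#}}"
  by (auto simp: omega_pow_def)

lemma lessThan_omega_pow_Suc:
  "bij_betw (\<lambda>(k, b). replicate_mset k n + b) (UNIV \<times> {..<omega_pow n}) {..<omega_pow (Suc n)}"
proof (rule bij_betwI[where g = "\<lambda>M. (count M n, filter_mset (\<lambda>j. j < n) M)"])
  show "(\<lambda>(k, b). replicate_mset k n + b) \<in> UNIV \<times> {..<omega_pow n} \<rightarrow> {..<omega_pow (Suc n)}"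
    by (fastforce simp: omega_pow_def less_Suc_eq split: if_splits)
  show "(\<lambda>M. (count M n, filter_mset (\<lambda>j. j < n) M)) \<in>
      {..<omega_pow (Suc n)} \<rightarrow> UNIV \<times> {..<omega_pow n}"
    by (auto simp: omega_pow_def)
next
  fix x :: "nat \<times> nat multiset"
  assume "x \<in> UNIV \<times> {..<omega_pow n}"
  then obtain k b where x: "x = (k, b)" and b: "\<forall>j\<in>#b. j < n"
    by (auto simp: omega_pow_def)
  have "count b n = 0"
    using b by (auto simp: count_eq_zero_iff)
  moreover have "filter_mset (\<lambda>j. j < n) b = b"
    using b by (simp add: filter_mset_eq_conv)
  moreover have "filter_mset (\<lambda>j. j < n) (replicate_mset k n) = {#}"
    by (intro multiset_eqI) simp
  ultimately show "(\<lambda>M. (count M n, filter_mset (\<lambda>j. j < n) M))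
      ((\<lambda>(k, b). replicate_mset k n + b) x) = x"
    by (simp add: x)
next
  fix M
  assume "M \<in> {..<omega_pow (Suc n)}"
  then have M: "\<forall>j\<in>#M. j \<le> n"
    by (auto simp: omega_pow_def less_Suc_eq_le)
  have "count M j = 0" if "n < j" for j
    using M that by (auto simp: count_eq_zero_iff)
  then show "(\<lambda>(k, b). replicate_mset k n + b) (count M n, filter_mset (\<lambda>j. j < n) M) = M"
    by (auto intro!: multiset_eqI simp: not_less le_less)
qed

lemma less_omega_pow_Suc_iff:
  assumes "b < omega_pow n" "b' < omega_pow n"
  shows "replicate_mset k n + b < replicate_mset k' n + b' \<longleftrightarrow> k < k' \<or> k = k' \<and> b < b'"
proof -
  have less: "replicate_mset k n + b < replicate_mset k' n + b'"
    if "k < k'" "b < omega_pow n" for k k' and b b' :: "nat multiset"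
  proof -
    obtain d where d: "k' = k + Suc d"
      using \<open>k < k'\<close> less_iff_Suc_add by auto
    have "b < {#n#}"
      using that by (simp add: omega_pow_def)
    also have "{#n#} \<le> replicate_mset (Suc d) n + b'"
      by (rule subset_eq_imp_le_multiset) simp
    finally have "replicate_mset k n + b < replicate_mset k n + (replicate_mset (Suc d) n + b')"
      by (rule add_strict_left_mono)
    also have "replicate_mset k n + (replicate_mset (Suc d) n + b') = replicate_mset k' n + b'"
      by (intro multiset_eqI) (simp add: d)
    finally show ?thesis .
  qed
  show ?thesis
    using less[of k k' b b'] less[of k' k b' b] assms
    by (cases k k' rule: linorder_cases) (auto dest: less_asym)
qed

section \<open>Ordinal automata\<close>

record ('a, 'q) ord_automaton =
  alphabet :: "'a set"
  states :: "'q set"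
  initial :: 'q
  succ_trans :: "('q \<times> 'a \<times> 'q) set"
  limit_trans :: "('q set \<times> 'q) set"
  final :: "'q set"

definition ord_automaton :: "('a, 'q) ord_automaton \<Rightarrow> bool" where
  "ord_automaton \<A> \<longleftrightarrow>
     finite (alphabet \<A>) \<and> finite (states \<A>) \<and> initial \<A> \<in> states \<A> \<and>
     succ_trans \<A> \<subseteq> states \<A> \<times> alphabet \<A> \<times> states \<A> \<and>
     limit_trans \<A> \<subseteq> Pow (states \<A>) \<times> states \<A> \<and>
     final \<A> \<subseteq> states \<A>"

definition is_succ :: "'o::wellorder \<Rightarrow> 'o \<Rightarrow> bool" where
  "is_succ i j \<longleftrightarrow> i < j \<and> (\<forall>k. i < k \<longrightarrow> j \<le> k)"

definition is_limit :: "'o::{wellorder, order_bot} \<Rightarrow> bool" where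
  "is_limit i \<longleftrightarrow> i \<noteq> bot \<and> (\<nexists>j. is_succ j i)"

definition words :: "'o::wellorder \<Rightarrow> 'a set \<Rightarrow> ('o \<Rightarrow> 'a) set" where
  "words \<alpha> S = {..<\<alpha>} \<rightarrow>\<^sub>E S"

definition Inf_states :: "('o::wellorder \<Rightarrow> 'q) \<Rightarrow> 'o \<Rightarrow> 'q set" where
  "Inf_states x i = {q. \<forall>j<i. \<exists>k. j \<le> k \<and> k < i \<and> x k = q}"

definition is_run ::
  "('a, 'q) ord_automaton \<Rightarrow> 'o::{wellorder, order_bot} \<Rightarrow> ('o \<Rightarrow> 'a) \<Rightarrow> ('o \<Rightarrow> 'q) \<Rightarrow> bool" where
  "is_run \<A> \<alpha> w x \<longleftrightarrow>
     x \<in> {..\<alpha>} \<rightarrow> states \<A> \<and>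
     x bot = initial \<A> \<and>
     (\<forall>i<\<alpha>. \<forall>j. is_succ i j \<longrightarrow> (x i, w i, x j) \<in> succ_trans \<A>) \<and>
     (\<forall>i\<le>\<alpha>. is_limit i \<longrightarrow> (Inf_states x i, x i) \<in> limit_trans \<A>)"

definition lang :: "'o::{wellorder, order_bot} \<Rightarrow> ('a, 'q) ord_automaton \<Rightarrow> ('o \<Rightarrow> 'a) set" where
  "lang \<alpha> \<A> = {w \<in> words \<alpha> (alphabet \<A>). \<exists>x. is_run \<A> \<alpha> w x \<and> x \<alpha> \<in> final \<A>}"

section \<open>Automatic structures\<close>

definition tuples :: "nat \<Rightarrow> 'a set \<Rightarrow> 'a list set" where
  "tuples k A = {xs. length xs = k \<and> set xs \<subseteq> A}"

text \<open>The arity is stored with each relation, since an empty relation does not determine it.\<close>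

record 'm rel_structure =
  universe :: "'m set"
  rels :: "(nat \<times> 'm list set) list"

definition convolution :: "'o::wellorder \<Rightarrow> ('o \<Rightarrow> 'a) list \<Rightarrow> 'o \<Rightarrow> 'a list" where
  "convolution \<alpha> ws = (\<lambda>i\<in>{..<\<alpha>}. map (\<lambda>w. w i) ws)"

definition accepted_rel ::
  "'o::{wellorder, order_bot} \<Rightarrow> 'a set \<Rightarrow> nat \<Rightarrow> ('a list, 'q) ord_automaton \<Rightarrow> ('o \<Rightarrow> 'a) list set" where
  "accepted_rel \<alpha> S k \<A> = {ws \<in> tuples k (words \<alpha> S). convolution \<alpha> ws \<in> lang \<alpha> \<A>}"

definition compatible :: "('m \<times> 'm) set \<Rightarrow> 'm list set \<Rightarrow> bool" where
  "compatible E R \<longleftrightarrow> (\<forall>us vs. list_all2 (\<lambda>u v. (u, v) \<in> E) us vs \<longrightarrow> us \<in> R \<longrightarrow> vs \<in> R)"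

definition quotient_structure :: "'m rel_structure \<Rightarrow> ('m \<times> 'm) set \<Rightarrow> 'm set rel_structure" where
  "quotient_structure \<M> E =
     \<lparr>universe = universe \<M> // E,
      rels = map (\<lambda>(k, R). (k, map (\<lambda>u. E `` {u}) ` R)) (rels \<M>)\<rparr>"

definition is_isomorphism :: "('m \<Rightarrow> 'n) \<Rightarrow> 'm rel_structure \<Rightarrow> 'n rel_structure \<Rightarrow> bool" where
  "is_isomorphism g \<M> \<N> \<longleftrightarrow>
     bij_betw g (universe \<M>) (universe \<N>) \<and>
     list_all2 (\<lambda>(k, R) (l, S). k = l \<and> (\<forall>xs \<in> tuples k (universe \<M>). xs \<in> R \<longleftrightarrow> map g xs \<in> S))
       (rels \<M>) (rels \<N>)"

text \<open>
  Letters and states of the automata are natural numbers. This is no restriction, because alphabets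
  and state sets are finite. Relations of arity \<open>k\<close> are read over the product alphabet of lists of
  length \<open>k\<close>.
\<close>

definition automatic :: "'o::{wellorder, order_bot} \<Rightarrow> 'm rel_structure \<Rightarrow> bool" where
  "automatic \<alpha> \<M> \<longleftrightarrow>
     (\<exists>(\<A> :: (nat, nat) ord_automaton) (\<A>eq :: (nat list, nat) ord_automaton)
        (\<A>s :: (nat list, nat) ord_automaton list) (h :: ('o \<Rightarrow> nat) \<Rightarrow> 'm) E Rs.
        ord_automaton \<A> \<and>
        ord_automaton \<A>eq \<and> alphabet \<A>eq = tuples 2 (alphabet \<A>) \<and>
        list_all2 (\<lambda>\<B> (k, R). ord_automaton \<B> \<and> alphabet \<B> = tuples k (alphabet \<A>)) \<A>s (rels \<M>) \<and>
        h ` lang \<alpha> \<A> = universe \<M> \<and>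
        E = {(u, v). [u, v] \<in> accepted_rel \<alpha> (alphabet \<A>) 2 \<A>eq} \<and>
        equiv (lang \<alpha> \<A>) E \<and>
        Rs = map2 (\<lambda>\<B> (k, R). (k, accepted_rel \<alpha> (alphabet \<A>) k \<B>)) \<A>s (rels \<M>) \<and>
        (\<forall>(k, R') \<in> set Rs. R' \<subseteq> tuples k (lang \<alpha> \<A>) \<and> compatible E R') \<and>
        (\<exists>g. (\<forall>u \<in> lang \<alpha> \<A>. g (E `` {u}) = h u) \<and>
             is_isomorphism g (quotient_structure \<lparr>universe = lang \<alpha> \<A>, rels = Rs\<rparr> E) \<M>))"

section \<open>The boolean algebra of subsets of \<open>\<omega>\<^sup>n\<close> modulo small sets\<close>

definition small_sets :: "nat \<Rightarrow> nat multiset set set" where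
  "small_sets n =
     {P. P \<subseteq> {..<omega_pow n} \<and> relation_of (\<le>) P <o relation_of (\<le>) {..<omega_pow n}}"

definition approx_rel :: "nat \<Rightarrow> (nat multiset set \<times> nat multiset set) set" where
  "approx_rel n =
     {(A, B). A \<subseteq> {..<omega_pow n} \<and> B \<subseteq> {..<omega_pow n} \<and> (A - B) \<union> (B - A) \<in> small_sets n}"

definition approx_class :: "nat \<Rightarrow> nat multiset set \<Rightarrow> nat multiset set set" where
  "approx_class n A = approx_rel n `` {A}"

text \<open>The relations are the graphs of the operations \<open>\<inter>\<close>, \<open>\<union>\<close>, \<open>\<not>\<close>, \<open>\<zero>\<close>, \<open>\<one>\<close>, in this order.\<close>

definition pow_omega_algebra :: "nat \<Rightarrow> nat multiset set set rel_structure" where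
  "pow_omega_algebra n =
     \<lparr>universe = Pow {..<omega_pow n} // approx_rel n,
      rels =
        [(3, {[approx_class n A, approx_class n B, approx_class n (A \<inter> B)] | A B.
               A \<subseteq> {..<omega_pow n} \<and> B \<subseteq> {..<omega_pow n}}),
         (3, {[approx_class n A, approx_class n B, approx_class n (A \<union> B)] | A B.
               A \<subseteq> {..<omega_pow n} \<and> B \<subseteq> {..<omega_pow n}}),
         (2, {[approx_class n A, approx_class n ({..<omega_pow n} - A)] | A.
               A \<subseteq> {..<omega_pow n}}),
         (1, {[approx_class n {}]}),
         (1, {[approx_class n {..<omega_pow n}]})]\<rparr>"

end

theory Submission
  imports Defs "HOL-Library.Infinite_Set"
begin

text \<open>
  A subset of \<open>\<omega>\<^bsup>n+1\<^esup>\<close> has full order type iff infinitely many of its \<open>\<omega>\<close> slices have full order type in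
  \<open>\<omega>\<^sup>n\<close>. A deterministic ordinal automaton can follow this recursion: it remembers for the block of
  length \<open>\<omega>\<^sup>k\<close> just completed whether it was full, and at the next limit of rank \<open>k + 1\<close> the cofinal states
  tell whether infinitely many of these blocks were. So smallness of any set that is defined letter by letter
  from words is recognisable. Coding subsets of \<open>\<omega>\<^sup>n\<close> by their characteristic words, equality in the quotient
  and the graphs of the operations all say that such a set, a symmetric difference, is small.
\<close>

section \<open>Order types of subsets of a well-order\<close>

lemma Field_relation_of_le: "Field (relation_of (\<le>) (P :: 'a::order set)) = P"
  by (auto simp: Field_def relation_of_def)

lemma Well_order_relation_of_le: "Well_order (relation_of (\<le>) (P :: 'a::wellorder set))"
proof -
  have "relation_of (\<le>) P - Id \<subseteq> {(x, y). x < y}"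
    by (auto simp: relation_of_def)
  then have "wf (relation_of (\<le>) P - Id)"
    using wf wf_subset by blast
  then show ?thesis
    unfolding well_order_on_def linear_order_on_def partial_order_on_def preorder_on_def
      Field_relation_of_le
    by (auto simp: relation_of_def refl_on_def trans_def antisym_def total_on_def)
qed

text \<open>At a least counterexample \<open>x\<close>, the value \<open>f x\<close> would be a
  smaller one. Hence no strictly increasing map sends \<open>{..<\<beta>}\<close> into a proper
  initial segment of itself, which drives both order type comparisons below.\<close>

lemma strict_mono_on_lessThan_ge:
  fixes f :: "'a::wellorder \<Rightarrow> 'a"
  assumes "strict_mono_on {..<\<beta>} f" "x < \<beta>"
  shows "x \<le> f x"
  using assms(2)
proof (induction x rule: less_induct)
  case (less x)
  show ?case
  proof (rule ccontr)
    assume "\<not> x \<le> f x"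
    then have "f x < x" by simp
    moreover have "f (f x) < f x"
      using \<open>f x < x\<close> less.prems assms(1) by (auto simp: strict_mono_on_def)
    ultimately show False
      using less.IH[of "f x"] less.prems by (meson leD less_trans)
  qed
qed

lemma embed_relation_of_le_strict_mono_on:
  fixes P Q :: "'a::wellorder set"
  assumes "embed (relation_of (\<le>) P) (relation_of (\<le>) Q) f"
  shows "strict_mono_on P f" "f ` P \<subseteq> Q"
proof -
  let ?p = "relation_of (\<le>) P" and ?q = "relation_of (\<le>) Q"
  have c: "compat ?p ?q f" and i: "inj_on f P" and "ofilter ?q (f ` P)"
    using assms embed_iff_compat_inj_on_ofilter[OF Well_order_relation_of_le Well_order_relation_of_le, of P Q f]
    by (auto simp: Field_relation_of_le)
  then show "f ` P \<subseteq> Q"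
    by (auto simp: Order_Relation.ofilter_def Field_relation_of_le)
  show "strict_mono_on P f"
  proof (rule strict_mono_onI)
    fix r s assume rs: "r \<in> P" "s \<in> P" "r < s"
    then have "(r, s) \<in> ?p" by (auto simp: relation_of_def)
    with c have "f r \<le> f s" by (auto simp: compat_def relation_of_def)
    moreover have "f r \<noteq> f s" using i rs by (auto dest: inj_onD)
    ultimately show "f r < f s" by simp
  qed
qed

text \<open>Well-orders are comparable, so a \<open>P\<close> that is not shorter than \<beta>
  receives an embedding of \<beta>. Conversely, an embedding of \<open>P\<close> onto a proper
  initial segment of \<beta>, composed with a strictly increasing map from \<beta> into
  \<open>P\<close>, would push \<beta> into a proper initial segment of itself.\<close>

lemma ordLess_lessThan_iff:
  fixes P :: "'a::wellorder set" and \<beta> :: 'a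
  shows "relation_of (\<le>) P <o relation_of (\<le>) {..<\<beta>} \<longleftrightarrow>
    \<not> (\<exists>f. strict_mono_on {..<\<beta>} f \<and> f ` {..<\<beta>} \<subseteq> P)" (is "?L \<longleftrightarrow> \<not> ?R")
proof
  assume ?L
  then obtain g where g: "embedS (relation_of (\<le>) P) (relation_of (\<le>) {..<\<beta>}) g"
    by (auto simp: ordLess_def)
  then have e: "embed (relation_of (\<le>) P) (relation_of (\<le>) {..<\<beta>}) g"
    by (simp add: embedS_def)
  have "g ` P \<subset> {..<\<beta>}"
    using embedS_Field[OF Well_order_relation_of_le g] by (simp add: Field_relation_of_le)
  \<comment> \<open>The image is an initial segment, so any value \<gamma> that it omits is a strict
    upper bound of it.\<close>
  then obtain \<gamma> where \<gamma>: "\<gamma> < \<beta>" "\<gamma> \<notin> g ` P" by auto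
  have "ofilter (relation_of (\<le>) {..<\<beta>}) (g ` P)"
    using embed_Field_ofilter[OF Well_order_relation_of_le Well_order_relation_of_le e]
    by (simp add: Field_relation_of_le)
  then have closed: "y \<in> g ` P" if "x \<in> g ` P" "y \<le> x" for x y
  proof -
    have "x < \<beta>" using that \<open>g ` P \<subset> {..<\<beta>}\<close> by blast
    then have "y \<in> under (relation_of (\<le>) {..<\<beta>}) x"
      using that(2) by (auto simp: under_def relation_of_def)
    moreover have "under (relation_of (\<le>) {..<\<beta>}) x \<subseteq> g ` P"
      using \<open>ofilter _ _\<close> that(1) by (auto simp: Order_Relation.ofilter_def)
    ultimately show ?thesis by blast
  qed
  have less: "g x < \<gamma>" if "x \<in> P" for x
    using closed[of "g x" \<gamma>] that \<gamma> by (meson imageI not_less)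
  show "\<not> ?R"
  proof
    assume ?R
    then obtain f where f: "strict_mono_on {..<\<beta>} f" "f ` {..<\<beta>} \<subseteq> P" by blast
    have "strict_mono_on {..<\<beta>} (g \<circ> f)"
      using f embed_relation_of_le_strict_mono_on(1)[OF e]
      by (auto simp: strict_mono_on_def image_subset_iff)
    then have "\<gamma> \<le> g (f \<gamma>)"
      using strict_mono_on_lessThan_ge[of \<beta> "g \<circ> f" \<gamma>] \<gamma> by simp
    moreover have "f \<gamma> \<in> P" using f \<gamma> by auto
    ultimately show False using less by fastforce
  qed
next
  assume "\<not> ?R"
  show ?L
  proof (rule ccontr)
    assume "\<not> ?L"
    then have "relation_of (\<le>) {..<\<beta>} \<le>o relation_of (\<le>) P"
      by (simp add: not_ordLess_iff_ordLeq Well_order_relation_of_le)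
    then obtain f where "embed (relation_of (\<le>) {..<\<beta>}) (relation_of (\<le>) P) f"
      by (auto simp: ordLeq_def)
    with \<open>\<not> ?R\<close> show False
      using embed_relation_of_le_strict_mono_on by blast
  qed
qed

section \<open>A recursive description of the subsets of order type \<open>\<omega>\<^sup>n\<close>\<close>

text \<open>Bounds \<open>b < {#n#}\<close> are kept as order statements, the form in which the
  slice lemmas expect them, instead of being unfolded to conditions on the exponents.\<close>

declare mset_lt_single_right_iff [simp del]

lemma less_omega_pow_SucE:
  assumes "M < {#Suc n#}"
  obtains k b where "M = replicate_mset k n + b" "b < {#n#}"
proof -
  have "M \<in> (\<lambda>(k, b). replicate_mset k n + b) ` (UNIV \<times> {..<omega_pow n})"
    using assms lessThan_omega_pow_Suc[of n] by (simp add: bij_betw_def omega_pow_def)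
  then show thesis using that by (auto simp: omega_pow_def)
qed

lemma replicate_mset_add_less_Suc: "b < {#n#} \<Longrightarrow> replicate_mset k n + b < {#Suc n#}"
  by (auto simp: mset_lt_single_right_iff less_Suc_eq split: if_splits)

lemmas less_replicate_mset_add_iff = less_omega_pow_Suc_iff[unfolded omega_pow_def]

text \<open>These projections invert the decomposition into slices and serve to define maps on
  \<open>{..<{#Suc n#}}\<close> slice by slice.\<close>

lemma count_filter_replicate_mset_add:
  fixes n :: nat
  assumes "b < {#n#}"
  shows "count (replicate_mset k n + b) n = k"
    "filter_mset (\<lambda>j. j < n) (replicate_mset k n + b) = b"
proof -
  have b: "\<forall>j\<in>#b. j < n"
    using assms by (simp add: mset_lt_single_right_iff)
  then show "count (replicate_mset k n + b) n = k"
    by (auto simp: count_eq_zero_iff)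
  show "filter_mset (\<lambda>j. j < n) (replicate_mset k n + b) = b"
    using b by (intro multiset_eqI) (auto simp: count_eq_zero_iff)
qed

text \<open>The slices need not be cut down to \<open>{..<{#n#}}\<close>: by
  \<open>full_type_mono\<close> only the elements below \<open>{#n#}\<close> influence the truth
  value.\<close>

primrec full_type :: "nat \<Rightarrow> nat multiset set \<Rightarrow> bool" where
  "full_type 0 P \<longleftrightarrow> {#} \<in> P"
| "full_type (Suc n) P \<longleftrightarrow> infinite {k. full_type n {b. replicate_mset k n + b \<in> P}}"

section \<open>Monotonicity and indecomposability of full sets\<close>

lemma full_type_mono: "full_type n P \<Longrightarrow> (\<And>b. b < {#n#} \<Longrightarrow> b \<in> P \<Longrightarrow> b \<in> Q) \<Longrightarrow> full_type n Q"
proof (induction n arbitrary: P Q)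
  case (Suc n)
  have "{k. full_type n {b. replicate_mset k n + b \<in> P}} \<subseteq> {k. full_type n {b. replicate_mset k n + b \<in> Q}}"
  proof
    fix k assume "k \<in> {k. full_type n {b. replicate_mset k n + b \<in> P}}"
    then have "full_type n {b. replicate_mset k n + b \<in> P}" by simp
    then have "full_type n {b. replicate_mset k n + b \<in> Q}"
      by (rule Suc.IH) (use Suc.prems(2) replicate_mset_add_less_Suc in blast)
    then show "k \<in> {k. full_type n {b. replicate_mset k n + b \<in> Q}}" by simp
  qed
  then show ?case using Suc.prems(1) infinite_super by auto
qed auto

lemma full_type_cong: "(\<And>b. b < {#n#} \<Longrightarrow> b \<in> P \<longleftrightarrow> b \<in> Q) \<Longrightarrow> full_type n P \<longleftrightarrow> full_type n Q"
  using full_type_mono by metis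

text \<open>This is the additive indecomposability of \<open>\<omega>^n\<close>: when two families
  of slice indices cover an infinite set, one of them is infinite. It makes the small sets closed
  under union.\<close>

lemma full_type_UnD: "full_type n (P \<union> Q) \<Longrightarrow> full_type n P \<or> full_type n Q"
proof (induction n arbitrary: P Q)
  case (Suc n)
  let ?I = "\<lambda>P. {k. full_type n {b. replicate_mset k n + b \<in> P}}"
  have "?I (P \<union> Q) \<subseteq> ?I P \<union> ?I Q"
  proof
    fix k assume "k \<in> ?I (P \<union> Q)"
    then have "full_type n ({b. replicate_mset k n + b \<in> P} \<union> {b. replicate_mset k n + b \<in> Q})"
      by (simp add: Collect_disj_eq)
    then show "k \<in> ?I P \<union> ?I Q" using Suc.IH by blast
  qed
  then show ?case using Suc.prems
    by (metis finite_UnI finite_subset full_type.simps(2))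
qed auto

lemma full_type_empty: "\<not> full_type n {}"
  by (induction n) auto

text \<open>The full slices are enumerated in increasing order, and the \<open>k\<close>-th slice of
  the domain is sent into the \<open>k\<close>-th full slice by the induction hypothesis.\<close>

lemma full_type_imp_strict_mono:
  "full_type n P \<Longrightarrow> \<exists>f. strict_mono_on {..<{#n#}} f \<and> f ` {..<{#n#}} \<subseteq> P \<inter> {..<{#n#}}"
proof (induction n arbitrary: P)
  case 0
  then have "strict_mono_on {..<{#0::nat#}} id \<and> id ` {..<{#0::nat#}} \<subseteq> P \<inter> {..<{#0::nat#}}"
    by (auto simp: mset_lt_single_right_iff strict_mono_on_def)
  then show ?case by blast
next
  case (Suc n)
  let ?S = "\<lambda>k. {b. replicate_mset k n + b \<in> P}"
  let ?I = "{k. full_type n (?S k)}"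
  have inf: "infinite ?I" using Suc.prems by simp
  define e where "e = Infinite_Set.enumerate ?I"
  have e: "e k < e k'" if "k < k'" for k k'
    using inf that by (simp add: e_def)
  have eI: "full_type n (?S (e k))" for k
    using enumerate_in_set[OF inf, of k] by (simp add: e_def)
  have "\<forall>k. \<exists>f. strict_mono_on {..<{#n#}} f \<and> f ` {..<{#n#}} \<subseteq> ?S (e k) \<inter> {..<{#n#}}"
    using Suc.IH eI by blast
  then obtain f where f: "\<And>k. strict_mono_on {..<{#n#}} (f k)"
      "\<And>k. f k ` {..<{#n#}} \<subseteq> ?S (e k) \<inter> {..<{#n#}}" by metis
  define g where "g M = (let k = count M n; b = filter_mset (\<lambda>j. j < n) M in replicate_mset (e k) n + f k b)" for M
  have g: "g (replicate_mset k n + b) = replicate_mset (e k) n + f k b" if "b < {#n#}" for k b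
    using that by (simp only: g_def Let_def count_filter_replicate_mset_add)
  have fb: "f k b < {#n#}" "replicate_mset (e k) n + f k b \<in> P" if "b < {#n#}" for k b
    using f(2)[of k] that by auto
  have "strict_mono_on {..<{#Suc n#}} g"
  proof (rule strict_mono_onI)
    fix r s assume "r \<in> {..<{#Suc n#}}" "s \<in> {..<{#Suc n#}}" and rs: "r < s"
    then obtain k b k' b' where *: "r = replicate_mset k n + b" "b < {#n#}"
      "s = replicate_mset k' n + b'" "b' < {#n#}"
      by (metis lessThan_iff less_omega_pow_SucE)
    then have "k < k' \<or> k = k' \<and> b < b'"
      using rs less_replicate_mset_add_iff by blast
    then have "e k < e k' \<or> e k = e k' \<and> f k b < f k' b'"
      using e f(1) * by (auto simp: strict_mono_on_def)
    then show "g r < g s"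
      using * fb by (simp add: g less_replicate_mset_add_iff)
  qed
  moreover have "g ` {..<{#Suc n#}} \<subseteq> P \<inter> {..<{#Suc n#}}"
  proof
    fix y assume "y \<in> g ` {..<{#Suc n#}}"
    then obtain k b where *: "y = g (replicate_mset k n + b)" "b < {#n#}"
      by (metis imageE lessThan_iff less_omega_pow_SucE)
    then show "y \<in> P \<inter> {..<{#Suc n#}}"
      using fb[of b k] replicate_mset_add_less_Suc[of "f k b"] by (simp add: g)
  qed
  ultimately show ?case by blast
qed

text \<open>
  Addition of multisets is the natural (Hessenberg) sum of ordinals. It is strictly monotone in both
  arguments and \<open>\<omega>\<^sup>n\<close> is closed under it, so partial natural sums of bounds for the small slices leave
  room to place the slices one after another below \<open>\<omega>\<^sup>n\<close>.
\<close>

lemma not_full_type_imp_bounded_strict_mono: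
  "\<not> full_type n P \<Longrightarrow>
    \<exists>f \<beta>. \<beta> < {#n#} \<and> strict_mono_on (P \<inter> {..<{#n#}}) f \<and> f ` (P \<inter> {..<{#n#}}) \<subseteq> {..<\<beta>}"
proof (induction n arbitrary: P)
  case 0
  then have "P \<inter> {..<{#0::nat#}} = {}"
    by (auto simp: mset_lt_single_right_iff)
  then show ?case
    by (intro exI[of _ id] exI[of _ "{#}"]) (auto simp: mset_lt_single_right_iff strict_mono_on_def)
next
  case (Suc n)
  let ?S = "\<lambda>k. {b. replicate_mset k n + b \<in> P}"
  let ?I = "{k. full_type n (?S k)}"
  have "finite ?I" using Suc.prems by simp
  \<comment> \<open>From \<open>K\<close> on no slice is full, so each of them is compressed below
    some \<open>\<beta> k\<close> by the induction hypothesis.\<close>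
  then obtain K where K: "\<And>k. k \<in> ?I \<Longrightarrow> k < K"
    unfolding finite_nat_set_iff_bounded by auto
  let ?T = "\<lambda>k. ?S k \<inter> {..<{#n#}}"
  have "\<exists>f \<beta>. \<beta> < {#n#} \<and> strict_mono_on (?T k) f \<and> f ` ?T k \<subseteq> {..<\<beta>}" if "k \<ge> K" for k
  proof -
    have "\<not> full_type n (?S k)" using K[of k] that by auto
    then show ?thesis by (rule Suc.IH)
  qed
  then have "\<forall>k\<in>{K..}. \<exists>f \<beta>. \<beta> < {#n#} \<and> strict_mono_on (?T k) f \<and> f ` ?T k \<subseteq> {..<\<beta>}"
    by blast
  then obtain f \<beta> where "\<forall>k\<in>{K..}. \<beta> k < {#n#} \<and> strict_mono_on (?T k) (f k) \<and> f k ` ?T k \<subseteq> {..<\<beta> k}"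
    unfolding bchoice_iff by blast
  then have f: "\<And>k. k \<ge> K \<Longrightarrow> \<beta> k < {#n#}"
      "\<And>k. k \<ge> K \<Longrightarrow> strict_mono_on (?T k) (f k)"
      "\<And>k. k \<ge> K \<Longrightarrow> f k ` ?T k \<subseteq> {..<\<beta> k}"
    by auto
  \<comment> \<open>Slices before \<open>K\<close> stay in place. All later ones are packed into the
    single copy of \<open>\<omega>^n\<close> that starts at \<open>replicate_mset K n\<close>, slice
    \<open>k\<close> being shifted by the natural sum of the earlier bounds.\<close>
  define F where "F k b = (if k < K then replicate_mset k n + b
     else replicate_mset K n + ((\<Sum>j=K..<k. \<beta> j) + f k b))" for k b
  define g where "g M = F (count M n) (filter_mset (\<lambda>j. j < n) M)" for M
  have g: "g (replicate_mset k n + b) = F k b" if "b < {#n#}" for k b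
    using that by (simp only: g_def Let_def count_filter_replicate_mset_add)
  have add: "a + b < {#n#}" if "a < {#n#}" "b < {#n#}" for a b
    using that by (auto simp: mset_lt_single_right_iff)
  have sum_less: "(\<Sum>j=K..<k. \<beta> j) < {#n#}" for k
  proof (induction k)
    case (Suc k)
    then show ?case using f(1)[of k] add by (cases "K \<le> k") auto
  qed simp
  have fb: "f k b < \<beta> k" "f k b < {#n#}" if "k \<ge> K" "b < {#n#}" "b \<in> ?S k" for k b
    using f(1)[of k] f(3)[of k] that by (auto simp: image_subset_iff intro: less_trans)
  \<comment> \<open>Since \<open>f k b < \<beta> k\<close>, slice \<open>k\<close> ends before the
    offset of slice \<open>Suc k\<close>, and hence before anything placed at the offset of a later
    slice \<open>k'\<close>.\<close>
  have step: "(\<Sum>j=K..<k. \<beta> j) + f k b < (\<Sum>j=K..<k'. \<beta> j) + c"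
    if "k \<ge> K" "b < {#n#}" "b \<in> ?S k" "k < k'" for k k' b c
  proof -
    have "(\<Sum>j=K..<k. \<beta> j) + f k b < (\<Sum>j=K..<Suc k. \<beta> j)"
      using fb that by simp
    also have "(\<Sum>j=K..<Suc k. \<beta> j) \<subseteq># (\<Sum>j=K..<Suc k. \<beta> j) + ((\<Sum>j=Suc k..<k'. \<beta> j) + c)"
      by simp
    then have "(\<Sum>j=K..<Suc k. \<beta> j) \<le> (\<Sum>j=K..<Suc k. \<beta> j) + ((\<Sum>j=Suc k..<k'. \<beta> j) + c)"
      by (rule subset_eq_imp_le_multiset)
    also have "\<dots> = (\<Sum>j=K..<k'. \<beta> j) + c"
      using sum.atLeastLessThan_concat[of K "Suc k" k' \<beta>] that by (simp add: add.assoc[symmetric])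
    finally show ?thesis .
  qed
  have mono: "F k b < F k' b'"
    if "b < {#n#}" "b \<in> ?S k" "b' < {#n#}" "b' \<in> ?S k'" "k < k' \<or> k = k' \<and> b < b'" for k k' b b'
  proof (cases "k < K")
    case True
    show ?thesis
    proof (cases "k' < K")
      case True
      then show ?thesis using \<open>k < K\<close> that by (simp add: F_def less_replicate_mset_add_iff)
    next
      case False
      then show ?thesis using \<open>k < K\<close> that add[OF sum_less[of k'] fb(2)[of k' b']]
        by (simp add: F_def less_replicate_mset_add_iff)
    qed
  next
    case False
    then have "k' \<ge> K" using that by auto
    then have "(\<Sum>j=K..<k. \<beta> j) + f k b < (\<Sum>j=K..<k'. \<beta> j) + f k' b'"
      using step[of k b k' "f k' b'"] that False f(2)[of k] by (auto simp: strict_mono_on_def)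
    then show ?thesis using False \<open>k' \<ge> K\<close> by (simp add: F_def)
  qed
  \<comment> \<open>The packed slices occupy only one further copy of \<open>\<omega>^n\<close>. The
    summand \<open>{#}\<close> gives the bound the shape required by
    \<open>less_replicate_mset_add_iff\<close>.\<close>
  have bound: "F k b < replicate_mset (Suc K) n + {#}" if "b < {#n#}" "b \<in> ?S k" for k b
  proof (cases "k < K")
    case True
    then show ?thesis using that less_replicate_mset_add_iff[of b n "{#}" k "Suc K"] by (simp add: F_def)
  next
    case False
    then show ?thesis
      using that add[OF sum_less[of k] fb(2)[of k b]]
        less_replicate_mset_add_iff[of "(\<Sum>j=K..<k. \<beta> j) + f k b" n "{#}" K "Suc K"] by (simp add: F_def)
  qed
  have "strict_mono_on (P \<inter> {..<{#Suc n#}}) g"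
  proof (rule strict_mono_onI)
    fix r s assume "r \<in> P \<inter> {..<{#Suc n#}}" "s \<in> P \<inter> {..<{#Suc n#}}" and rs: "r < s"
    moreover from this obtain k b k' b' where *: "r = replicate_mset k n + b" "b < {#n#}"
      "s = replicate_mset k' n + b'" "b' < {#n#}"
      by (metis IntD2 lessThan_iff less_omega_pow_SucE)
    ultimately show "g r < g s"
      using less_replicate_mset_add_iff[of b n b' k k'] mono[of b k b' k'] by (simp add: g)
  qed
  moreover have "g ` (P \<inter> {..<{#Suc n#}}) \<subseteq> {..<replicate_mset (Suc K) n + {#}}"
  proof (rule image_subsetI)
    fix r assume "r \<in> P \<inter> {..<{#Suc n#}}"
    moreover from this obtain k b where *: "r = replicate_mset k n + b" "b < {#n#}"
      by (metis IntD2 lessThan_iff less_omega_pow_SucE)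
    ultimately show "g r \<in> {..<replicate_mset (Suc K) n + {#}}"
      using bound[of b k] by (simp add: g)
  qed
  moreover have "replicate_mset (Suc K) n + {#} < {#Suc n#}"
    by (rule replicate_mset_add_less_Suc) simp
  ultimately show ?case by blast
qed

text \<open>For the converse, the compression of a set that is not full, composed with
  \<open>f\<close>, would map \<open>{..<{#n#}}\<close> strictly increasingly below some smaller
  \<beta>.\<close>

lemma full_type_iff_strict_mono:
  "full_type n P \<longleftrightarrow> (\<exists>f. strict_mono_on {..<{#n#}} f \<and> f ` {..<{#n#}} \<subseteq> P \<inter> {..<{#n#}})"
proof
  assume "\<exists>f. strict_mono_on {..<{#n#}} f \<and> f ` {..<{#n#}} \<subseteq> P \<inter> {..<{#n#}}"
  then obtain f where f: "strict_mono_on {..<{#n#}} f" "f ` {..<{#n#}} \<subseteq> P \<inter> {..<{#n#}}" by blast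
  show "full_type n P"
  proof (rule ccontr)
    assume "\<not> full_type n P"
    then obtain g \<beta> where g: "\<beta> < {#n#}" "strict_mono_on (P \<inter> {..<{#n#}}) g"
        "g ` (P \<inter> {..<{#n#}}) \<subseteq> {..<\<beta>}"
      using not_full_type_imp_bounded_strict_mono by blast
    have "strict_mono_on {..<{#n#}} (g \<circ> f)"
    proof (rule strict_mono_onI)
      fix r s assume "r \<in> {..<{#n#}}" "s \<in> {..<{#n#}}" "r < s"
      then show "(g \<circ> f) r < (g \<circ> f) s"
        using f g(2) unfolding comp_def by (meson imageI strict_mono_onD subsetD)
    qed
    then have "\<beta> \<le> g (f \<beta>)"
      using strict_mono_on_lessThan_ge[of "{#n#}" "g \<circ> f" \<beta>] g by simp
    moreover have "f \<beta> \<in> P \<inter> {..<{#n#}}" using f(2) g(1) by blast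
    ultimately show False using g(3) by (meson imageI lessThan_iff not_less subsetD)
  qed
qed (rule full_type_imp_strict_mono)

text \<open>Both the ordinal comparison and the recursion have been reduced to the existence of a
  strictly increasing map from \<open>{..<{#n#}}\<close> into \<open>P\<close>.\<close>

lemma small_sets_iff: "P \<in> small_sets n \<longleftrightarrow> P \<subseteq> {..<omega_pow n} \<and> \<not> full_type n P"
proof (cases "P \<subseteq> {..<{#n#}}")
  case True
  then have "P \<inter> {..<{#n#}} = P" by blast
  then show ?thesis using True
    by (simp add: small_sets_def omega_pow_def ordLess_lessThan_iff full_type_iff_strict_mono)
qed (simp add: small_sets_def omega_pow_def)

section \<open>Successor and limit positions\<close>

text \<open>Ordinals with all exponents at least \<open>m\<close> are the multiples of
  \<open>\<omega>^m\<close>, and consecutive multiples differ by \<open>\<omega>^m\<close>. In the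
  Dershowitz-Manna form of \<open>A < B\<close>, the added \<open>m\<close> can be charged to the
  replaced part \<open>X\<close>.\<close>

lemma add_mset_le_of_less:
  fixes A B :: "nat multiset"
  assumes "A < B" "\<forall>j\<in>#A. m \<le> j" "\<forall>j\<in>#B. m \<le> j"
  shows "add_mset m A \<le> B"
proof -
  obtain X Y where XY: "X \<noteq> {#}" "X \<subseteq># B" "A = (B - X) + Y" "\<forall>k. k \<in># Y \<longrightarrow> (\<exists>a. a \<in># X \<and> k < a)"
    using assms(1) by (auto simp: less_multiset\<^sub>D\<^sub>M)
  have B: "B = (B - X) + X" using XY(2) by simp
  have "add_mset m Y \<le> X"
  \<comment> \<open>If \<open>Y\<close> is empty, \<open>X\<close> may be just \<open>{#m#}\<close>,
    which allows equality. Otherwise \<open>m\<close> is at most some \<open>y\<close> in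
    \<open>Y\<close>, hence strictly below an element of \<open>X\<close>.\<close>
  proof (cases "Y = {#}")
    case True
    obtain a where a: "a \<in># X" using XY(1) by blast
    then have "m \<le> a" using assms(3) mset_subset_eqD[OF XY(2)] by simp
    then have "{#m#} \<le> {#a#}" by (auto simp: mset_lt_single_right_iff le_less)
    also have "{#a#} \<le> X" using a by (intro subset_eq_imp_le_multiset) simp
    finally show ?thesis using True by simp
  next
    case False
    then obtain y where y: "y \<in># Y" by blast
    then have "m \<le> y" using assms(2) XY(3) by simp
    moreover obtain a where "a \<in># X" "y < a" using XY(4) y by blast
    ultimately have "\<exists>a. a \<in># X \<and> k < a" if "k \<in># add_mset m Y" for k
      using that XY(4) by (auto intro: le_less_trans)
    then have "\<exists>J K. J \<noteq> {#} \<and> J \<subseteq># X \<and> add_mset m Y = (X - J) + K \<and> (\<forall>k. k \<in># K \<longrightarrow> (\<exists>a. a \<in># J \<and> k < a))"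
      using XY(1) by (intro exI[of _ X] exI[of _ "add_mset m Y"]) auto
    then show ?thesis by (intro less_imp_le) (simp add: less_multiset\<^sub>D\<^sub>M)
  qed
  then have "(B - X) + add_mset m Y \<le> (B - X) + X" by (rule add_left_mono)
  then show ?thesis using XY(3) B by simp
qed

text \<open>This is \<open>add_mset_le_of_less\<close> at \<open>m = 0\<close>: the next multiple of
  1.\<close>

lemma is_succ_mset_iff: "is_succ i j \<longleftrightarrow> j = add_mset (0::nat) i"
proof
  assume "is_succ i j"
  then show "j = add_mset 0 i"
    using add_mset_le_of_less[of i j 0] le_multiset_right_total[of i 0]
    by (auto simp: is_succ_def intro: antisym)
qed (auto simp: is_succ_def le_multiset_right_total intro: add_mset_le_of_less)

text \<open>This splits off the last term of the Cantor normal form, whose exponent tells successors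
  (\<open>k = 0\<close>) from limits.\<close>

lemma mset_eq_add_MinE:
  fixes i :: "nat multiset"
  assumes "i \<noteq> {#}"
  obtains M k where "i = M + {#k#}" "\<forall>j\<in>#M. k \<le> j"
proof
  have "Min_mset i \<in># i" using assms by simp
  then show "i = (i - {#Min_mset i#}) + {#Min_mset i#}" by simp
  show "\<forall>j\<in>#i - {#Min_mset i#}. Min_mset i \<le> j"
    by (meson Min_le finite_set_mset in_diffD)
qed

text \<open>Let \<open>c\<close> collect the terms of \<open>z\<close> with exponent below
  \<open>m\<close>. The rest is a multiple of \<open>\<omega>^m\<close>, and the gap between
  distinct multiples forces it to be \<open>M\<close>.\<close>

lemma less_add_single_msetE:
  fixes z M :: "nat multiset"
  assumes "M \<le> z" "z < M + {#m#}" "\<forall>j\<in>#M. m \<le> j"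
  obtains c where "z = M + c" "c < {#m#}"
proof -
  define A c where "A = filter_mset (\<lambda>j. m \<le> j) z" and "c = filter_mset (\<lambda>j. \<not> m \<le> j) z"
  have z: "z = A + c" by (simp add: A_def c_def multiset_partition)
  have c: "c < {#m#}" by (auto simp: c_def mset_lt_single_right_iff)
  have A: "\<forall>j\<in>#A. m \<le> j" by (simp add: A_def)
  have "\<not> A < M"
  proof
    assume "A < M"
    have "z < A + {#m#}" using c by (simp add: z)
    also have "\<dots> \<le> M" using add_mset_le_of_less[OF \<open>A < M\<close> A assms(3)] by simp
    finally show False using assms(1) by simp
  qed
  moreover have "\<not> M < A"
  proof
    assume "M < A"
    then have "M + {#m#} \<le> A" using add_mset_le_of_less[OF _ assms(3) A] by simp
    also have "A \<le> z" unfolding z by (intro subset_eq_imp_le_multiset) simp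
    finally show False using assms(2) by simp
  qed
  ultimately have "A = M" by simp
  with z c that show thesis by blast
qed

section \<open>The automaton recognising sets of order type \<open>\<omega>\<^sup>n\<close>\<close>

text \<open>
  At a position whose least exponent is \<open>k\<close>, the state \<open>2k\<close> or \<open>2k + 1\<close> records whether the preceding
  block of length \<open>\<omega>\<^sup>k\<close> meets \<open>P\<close> in order type \<open>\<omega>\<^sup>k\<close>.
\<close>

definition block_state :: "nat multiset set \<Rightarrow> nat multiset \<Rightarrow> nat" where
  "block_state P i = (if i = {#} then 0 else
     2 * Min_mset i + of_bool (full_type (Min_mset i) {b. (i - {#Min_mset i#}) + b \<in> P}))"

lemma block_state_add_single:
  assumes "\<forall>j\<in>#M. k \<le> j"
  shows "block_state P (M + {#k#}) = 2 * k + of_bool (full_type k {b. M + b \<in> P})"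
proof -
  have "Min_mset (M + {#k#}) = k" using assms by (intro Min_eqI) auto
  then show ?thesis by (simp add: block_state_def)
qed

lemma block_state_le: "i \<noteq> {#} \<Longrightarrow> block_state P i \<le> 2 * Min_mset i + 1"
  by (simp add: block_state_def)

text \<open>Hence at limits the next state is always \<open>Max S + 2\<close>, where \<open>S\<close> is the set of cofinal states.\<close>

lemma Inf_states_block_state:
  fixes P :: "nat multiset set"
  assumes "\<forall>j\<in>#M. Suc k \<le> j"
  defines "s \<equiv> 2 * k + of_bool (full_type (Suc k) {b. M + b \<in> P})"
  shows "s \<in> Inf_states (block_state P) (M + {#Suc k#})"
    and "\<And>q. q \<in> Inf_states (block_state P) (M + {#Suc k#}) \<Longrightarrow> q \<le> s"
proof -
  let ?i = "M + {#Suc k#}"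
  \<comment> \<open>\<open>?L j\<close> says that the \<open>j\<close>-th block of length
    \<open>\<omega>^k\<close> after \<open>M\<close> is full, and \<open>?p j\<close> is where this
    block begins. Its fullness is thus reported at \<open>?p (Suc j)\<close>.\<close>
  let ?L = "\<lambda>j. full_type k {b. M + (replicate_mset j k + b) \<in> P}"
  let ?p = "\<lambda>j. M + replicate_mset j k"
  have s: "s = 2 * k + of_bool (infinite {j. ?L j})" by (simp add: s_def)
  have p_state: "block_state P (?p (Suc j)) = 2 * k + of_bool (?L j)" for j
  proof -
    have "\<forall>l\<in>#?p j. k \<le> l" using assms(1) by (auto split: if_splits)
    from block_state_add_single[OF this] show ?thesis by (simp add: add.assoc)
  qed
  have p_less: "?p j < ?i" for j
    using replicate_mset_add_less_Suc[of "{#}" k j] by (simp add: mset_lt_single_right_iff)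
  have p_mono: "?p j \<le> ?p j'" if "j \<le> j'" for j j'
    using that by (intro subset_eq_imp_le_multiset) (simp add: subseteq_mset_def)
  have cofinal: "\<exists>j. z \<le> ?p j" if "z < ?i" for z
  proof (cases "z < M")
    case True
    then show ?thesis by (intro exI[of _ 0]) simp
  next
    case False
    then have "M \<le> z" by simp
    then obtain c where c: "z = M + c" "c < {#Suc k#}"
      using \<open>z < ?i\<close> assms(1) by (rule less_add_single_msetE)
    then obtain j b where jb: "c = replicate_mset j k + b" "b < {#k#}"
      using less_omega_pow_SucE by blast
    have "c < replicate_mset (Suc j) k + {#}"
      unfolding jb(1) using jb(2) by (subst less_replicate_mset_add_iff) auto
    then have "z \<le> ?p (Suc j)" by (simp add: c(1))
    then show ?thesis by blast
  qed
  \<comment> \<open>With infinitely many full blocks the odd state recurs; otherwise every block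
    from \<open>J\<close> on yields the even one.\<close>
  have s_cofinal: "\<exists>j'\<ge>j. block_state P (?p (Suc j')) = s" for j
  proof (cases "infinite {j. ?L j}")
    case True
    then obtain j' where "j' \<ge> j" "?L j'"
      using infinite_nat_iff_unbounded_le[of "{j. ?L j}"] by blast
    with True show ?thesis using p_state[of j'] by (auto simp: s)
  next
    case False
    then obtain J where J: "\<And>j. ?L j \<Longrightarrow> j < J"
      unfolding not_not finite_nat_set_iff_bounded by auto
    then have "\<not> ?L (max j J)" using J[of "max j J"] by linarith
    with False show ?thesis using p_state[of "max j J"] by (intro exI[of _ "max j J"]) (simp add: s)
  qed
  show "s \<in> Inf_states (block_state P) ?i"
    unfolding Inf_states_def
  proof (intro CollectI allI impI)
    fix z assume "z < ?i"
    then obtain j where "z \<le> ?p j" using cofinal by blast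
    moreover obtain j' where j': "j' \<ge> j" "block_state P (?p (Suc j')) = s"
      using s_cofinal by blast
    moreover have "?p j \<le> ?p (Suc j')" using j'(1) by (intro p_mono) simp
    ultimately have "z \<le> ?p (Suc j')" by (meson order_trans)
    then show "\<exists>y\<ge>z. y < ?i \<and> block_state P y = s"
      using j' p_less by blast
  qed
  show "q \<le> s" if q: "q \<in> Inf_states (block_state P) ?i" for q
  proof -
    \<comment> \<open>If only finitely many blocks are full, \<open>J\<close> lies beyond their
      indices. In the other case both states of rank \<open>k\<close> are allowed by
      \<open>s\<close>, and the condition is vacuous.\<close>
    obtain J where J: "finite {j. ?L j} \<Longrightarrow> ?L j \<Longrightarrow> j < J" for j
    proof (cases "finite {j. ?L j}")
      case True
      then obtain J where "\<forall>j\<in>{j. ?L j}. j < J" unfolding finite_nat_set_iff_bounded by blast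
      then show thesis by (intro that[of J]) auto
    qed (use that in blast)
    obtain y where y: "?p (Suc J) \<le> y" "y < ?i" "block_state P y = q"
      using q p_less[of "Suc J"] unfolding Inf_states_def by blast
    have "M \<le> ?p (Suc J)" using p_mono[of 0 "Suc J"] by simp
    then have "M \<le> y" using y(1) by (rule order_trans)
    then obtain c where c: "y = M + c" "c < {#Suc k#}"
      using y(2) assms(1) by (rule less_add_single_msetE)
    then obtain j b where jb: "c = replicate_mset j k + b" "b < {#k#}"
      using less_omega_pow_SucE by blast
    have Jc: "replicate_mset (Suc J) k \<le> c" using y(1) by (simp add: c(1))
    show "q \<le> s"
    proof (cases "b = {#}")
      case True
      have "\<not> j < Suc J"
        using Jc less_replicate_mset_add_iff[of "{#}" k "{#}" j "Suc J"] by (auto simp: jb(1) True)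
      then obtain j' where j': "j = Suc j'" "j' \<ge> J" by (cases j) auto
      then have "q = 2 * k + of_bool (?L j')"
        using y(3) p_state[of j'] by (simp add: c(1) jb(1) True)
      moreover have "\<not> ?L j'" if "finite {j. ?L j}" using J[OF that, of j'] j' by auto
      ultimately show ?thesis by (auto simp: s)
    next
      case False
      \<comment> \<open>Off the block boundaries the least exponent is below \<open>k\<close>, so
        the state is at most \<open>2 * k - 1\<close> and cannot exceed \<open>s\<close>.\<close>
      then obtain l where l: "l \<in># b" by blast
      then have "l < k" using jb(2) by (simp add: mset_lt_single_right_iff)
      moreover have "Min_mset y \<le> l" using l by (intro Min_le) (auto simp: c(1) jb(1))
      moreover have "y \<noteq> {#}" using l by (auto simp: c(1) jb(1))
      ultimately show ?thesis using block_state_le[of y P] y(3) by (simp add: s)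
    qed
  qed
qed

text \<open>A successor step completes a block of length 1, so the new state depends on the letter
  alone. Limit transitions require a nonempty \<open>T\<close>, for which \<open>Max T\<close> is
  meaningful, and stay within the state set. \<open>F\<close> is a parameter so that the same
  automaton can accept all words or only those defining a small set.\<close>

definition block_automaton :: "'a set \<Rightarrow> nat \<Rightarrow> ('a \<Rightarrow> bool) \<Rightarrow> nat set \<Rightarrow> ('a, nat) ord_automaton" where
  "block_automaton S n \<phi> F =
     \<lparr>alphabet = S, states = {..2 * n + 1}, initial = 0,
      succ_trans = {(q, a, of_bool (\<phi> a)) | q a. q \<le> 2 * n + 1 \<and> a \<in> S},
      limit_trans = {(T, Max T + 2) | T. T \<noteq> {} \<and> T \<subseteq> {..2 * n + 1} \<and> Max T + 2 \<le> 2 * n + 1},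
      final = F\<rparr>"

lemma ord_automaton_block_automaton:
  "finite S \<Longrightarrow> F \<subseteq> {..2 * n + 1} \<Longrightarrow> ord_automaton (block_automaton S n \<phi> F)"
  by (auto simp: ord_automaton_def block_automaton_def)

lemma block_state_le_omega_pow: "i \<le> {#n#} \<Longrightarrow> block_state P i \<le> 2 * n + 1"
proof (cases "i = {#}")
  case False
  assume "i \<le> {#n#}"
  have "Min_mset i \<in># i" using False by simp
  then have "Min_mset i \<le> n" using \<open>i \<le> {#n#}\<close> by auto
  then show ?thesis using block_state_le[OF False, of P] by linarith
qed (simp add: block_state_def)

text \<open>A limit position has least exponent \<open>Suc k\<close> for some \<open>k\<close>. Its
  greatest cofinal state has rank \<open>k\<close> and already carries the fullness bit of the block
  of rank \<open>Suc k\<close> ending there; adding 2 raises the rank and keeps the bit.\<close>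

lemma Max_Inf_states_block_state:
  fixes P :: "nat multiset set"
  assumes "is_limit i" "i \<le> {#n#}"
  defines "T \<equiv> Inf_states (block_state P) i"
  shows "T \<noteq> {}" "T \<subseteq> {..2 * n + 1}" "Max T + 2 = block_state P i"
proof -
  have "i \<noteq> {#}" using assms(1) by (simp add: is_limit_def bot_multiset_def)
  then obtain M l where i: "i = M + {#l#}" "\<forall>j\<in>#M. l \<le> j" using mset_eq_add_MinE by metis
  have "is_succ M i" if "l = 0"
    using that by (simp add: is_succ_mset_iff i(1))
  then have "l \<noteq> 0" using assms(1) by (auto simp: is_limit_def)
  then obtain k where l: "l = Suc k" by (cases l) auto
  note s = Inf_states_block_state[OF i(2)[unfolded l], where P = P, folded i(1)[unfolded l] T_def]
  show "T \<noteq> {}" using s(1) by blast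
  show sub: "T \<subseteq> {..2 * n + 1}"
  proof
    fix q assume "q \<in> T"
    moreover have "{#} < i" using \<open>i \<noteq> {#}\<close> by simp
    ultimately obtain y where "y < i" "block_state P y = q"
      unfolding T_def Inf_states_def by blast
    moreover from this have "y \<le> {#n#}" using assms(2) by (metis less_imp_le less_le_trans)
    ultimately show "q \<in> {..2 * n + 1}"
      using block_state_le_omega_pow[of y n P] by simp
  qed
  have "Max T = 2 * k + of_bool (full_type (Suc k) {b. M + b \<in> P})"
    using s sub by (intro Max_eqI) (auto intro: finite_subset)
  then show "Max T + 2 = block_state P i"
    using block_state_add_single[OF i(2), of P] by (simp add: i(1) l)
qed

section \<open>The unique run and the language of the automaton\<close>

lemma is_run_block_automaton:
  assumes w: "w \<in> words {#n#} S"
  shows "is_run (block_automaton S n \<phi> F) {#n#} w (block_state {i. \<phi> (w i)})"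
proof -
  let ?P = "{i. \<phi> (w i)}"
  have w_in: "w i \<in> S" if "i < {#n#}" for i
    using w that by (auto simp: words_def)
  have succ: "block_state ?P (add_mset 0 i) = of_bool (\<phi> (w i))" for i
    using block_state_add_single[of i 0 ?P] by simp
  note le = block_state_le_omega_pow[of _ n ?P]
  show ?thesis
    unfolding is_run_def
  proof (intro conjI allI impI)
    show "block_state ?P \<in> {..{#n#}} \<rightarrow> states (block_automaton S n \<phi> F)"
      using le by (auto simp: block_automaton_def simp del: mset_le_single_right_iff)
    show "block_state ?P bot = initial (block_automaton S n \<phi> F)"
      by (simp add: block_automaton_def block_state_def bot_multiset_def)
  next
    fix i j assume "i < {#n#}" "is_succ i j"
    then show "(block_state ?P i, w i, block_state ?P j) \<in> succ_trans (block_automaton S n \<phi> F)"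
      using le[OF less_imp_le] w_in by (simp add: block_automaton_def is_succ_mset_iff succ)
  next
    fix i assume "i \<le> {#n#}" "is_limit i"
    then have "block_state ?P i \<le> 2 * n + 1" and T: "Inf_states (block_state ?P) i \<noteq> {}"
      "Inf_states (block_state ?P) i \<subseteq> {..2 * n + 1}"
      "Max (Inf_states (block_state ?P) i) + 2 = block_state ?P i"
      using le Max_Inf_states_block_state by blast+
    then show "(Inf_states (block_state ?P) i, block_state ?P i) \<in> limit_trans (block_automaton S n \<phi> F)"
      by (simp add: block_automaton_def)
  qed
qed

lemma Inf_states_cong: "(\<And>k. k < i \<Longrightarrow> x k = y k) \<Longrightarrow> Inf_states x i = Inf_states y i"
  unfolding Inf_states_def by (intro Collect_cong) metis

text \<open>The initial state is given, the letter determines the state at a successor, and at a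
  limit the cofinal states depend only on earlier positions, which are known by induction.\<close>

lemma is_run_block_automaton_unique:
  assumes run: "is_run (block_automaton S n \<phi> F) {#n#} w x" and "i \<le> {#n#}"
  shows "x i = block_state {i. \<phi> (w i)} i"
  using assms(2)
proof (induction i rule: less_induct)
  case (less i)
  let ?P = "{i. \<phi> (w i)}"
  consider "i = {#}" | j where "i = add_mset 0 j" | "is_limit i"
    by (auto simp: is_limit_def is_succ_mset_iff bot_multiset_def)
  then show ?case
  proof cases
    case 1
    then show ?thesis using run by (simp add: is_run_def bot_multiset_def block_automaton_def block_state_def)
  next
    case (2 j)
    then have "j < {#n#}" using less.prems le_multiset_right_total[of j 0] by (metis less_le_trans)
    then have "x i = of_bool (\<phi> (w j))"
      using run by (auto simp: is_run_def is_succ_mset_iff block_automaton_def 2)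
    then show ?thesis using block_state_add_single[of j 0 ?P] by (simp add: 2)
  next
    case 3
    have "Inf_states x i = Inf_states (block_state ?P) i"
      using less by (intro Inf_states_cong) (meson less_imp_le less_le_trans)
    moreover have "(Inf_states x i, x i) \<in> limit_trans (block_automaton S n \<phi> F)"
      using run 3 less.prems unfolding is_run_def by blast
    ultimately show ?thesis
      using Max_Inf_states_block_state(3)[OF 3 less.prems, of ?P] by (simp add: block_automaton_def)
  qed
qed

text \<open>At position \<open>{#n#}\<close> the block just completed is all of
  \<open>\<omega>^n\<close>, so the last state of the only run is \<open>2 * n\<close> plus the
  fullness bit of the whole set.\<close>

lemma lang_block_automaton:
  "lang {#n#} (block_automaton S n \<phi> F) =
     {w \<in> words {#n#} S. 2 * n + of_bool (full_type n {i. \<phi> (w i)}) \<in> F}"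
proof -
  have state: "block_state P {#n#} = 2 * n + of_bool (full_type n P)" for P
    using block_state_add_single[of "{#}" n P] by simp
  have proj: "alphabet (block_automaton S n \<phi> F) = S" "final (block_automaton S n \<phi> F) = F"
    by (simp_all add: block_automaton_def)
  have run: "(\<exists>x. is_run (block_automaton S n \<phi> F) {#n#} w x \<and> x {#n#} \<in> F) \<longleftrightarrow>
      block_state {i. \<phi> (w i)} {#n#} \<in> F" if "w \<in> words {#n#} S" for w
  proof
    assume "\<exists>x. is_run (block_automaton S n \<phi> F) {#n#} w x \<and> x {#n#} \<in> F"
    then obtain x where x: "is_run (block_automaton S n \<phi> F) {#n#} w x" "x {#n#} \<in> F" by blast
    then show "block_state {i. \<phi> (w i)} {#n#} \<in> F"
      using is_run_block_automaton_unique[OF x(1) order_refl] by simp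
  qed (use is_run_block_automaton[OF that] in blast)
  show ?thesis
    unfolding lang_def proj by (intro Collect_cong conj_cong refl) (simp only: run state)
qed

section \<open>Automatic presentations\<close>

text \<open>When every word is a code and the accepted equivalence is the kernel of
  \<open>h\<close>, compatibility and the isomorphism of the quotient follow from a check of each
  relation on tuples of words.\<close>

lemma automaticI:
  fixes \<A> :: "(nat, nat) ord_automaton" and \<A>eq :: "(nat list, nat) ord_automaton"
    and \<A>s :: "(nat list, nat) ord_automaton list"
    and \<alpha> :: "'o::{wellorder, order_bot}" and h :: "('o \<Rightarrow> nat) \<Rightarrow> 'm"
  assumes \<A>: "ord_automaton \<A>" "lang \<alpha> \<A> = words \<alpha> (alphabet \<A>)"
    and \<A>eq: "ord_automaton \<A>eq" "alphabet \<A>eq = tuples 2 (alphabet \<A>)"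
    and h: "h ` words \<alpha> (alphabet \<A>) = universe \<M>"
    and eq: "\<And>u v. u \<in> words \<alpha> (alphabet \<A>) \<Longrightarrow> v \<in> words \<alpha> (alphabet \<A>) \<Longrightarrow>
      [u, v] \<in> accepted_rel \<alpha> (alphabet \<A>) 2 \<A>eq \<longleftrightarrow> h u = h v"
    and rels: "list_all2 (\<lambda>\<B> (k, R). ord_automaton \<B> \<and> alphabet \<B> = tuples k (alphabet \<A>) \<and>
      (\<forall>us \<in> tuples k (words \<alpha> (alphabet \<A>)). us \<in> accepted_rel \<alpha> (alphabet \<A>) k \<B> \<longleftrightarrow> map h us \<in> R))
      \<A>s (rels \<M>)"
  shows "automatic \<alpha> \<M>"
proof -
  define L where "L = words \<alpha> (alphabet \<A>)"
  define E where "E = {(u, v). [u, v] \<in> accepted_rel \<alpha> (alphabet \<A>) 2 \<A>eq}"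
  define Rs where "Rs = map2 (\<lambda>\<B> (k, R). (k, accepted_rel \<alpha> (alphabet \<A>) k \<B>)) \<A>s (rels \<M>)"
  \<comment> \<open>On an \<open>E\<close>-class the map \<open>h\<close> is constant, and
    \<open>g\<close> picks out that common value.\<close>
  define g where "g X = (THE y. h ` X = {y})" for X
  have E_iff: "(u, v) \<in> E \<longleftrightarrow> u \<in> L \<and> v \<in> L \<and> h u = h v" for u v
  proof -
    have "(u, v) \<in> E \<Longrightarrow> u \<in> L \<and> v \<in> L"
      by (auto simp: E_def accepted_rel_def tuples_def L_def)
    then show ?thesis using eq[of u v] by (auto simp: E_def L_def)
  qed
  have equiv: "equiv L E"
    by (rule equivI) (auto simp: refl_on_def sym_def trans_def E_iff)
  have g: "g (E `` {u}) = h u" if "u \<in> L" for u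
  proof -
    have "h ` (E `` {u}) = {h u}" using that by (auto simp: E_iff)
    then show ?thesis by (simp add: g_def)
  qed
  have inj: "E `` {u} = E `` {v} \<longleftrightarrow> h u = h v" if "u \<in> L" "v \<in> L" for u v
    using eq_equiv_class_iff[OF equiv that] that by (simp add: E_iff)
  have len: "length \<A>s = length (rels \<M>)"
    using rels by (rule list_all2_lengthD)
  have accepted_subset: "accepted_rel \<alpha> (alphabet \<A>) k \<B> \<subseteq> tuples k L" for k and \<B> :: "(nat list, nat) ord_automaton"
    by (auto simp: accepted_rel_def L_def)
  have nth: "\<exists>k R. rels \<M> ! i = (k, R) \<and> Rs ! i = (k, accepted_rel \<alpha> (alphabet \<A>) k (\<A>s ! i)) \<and>
      (\<forall>us \<in> tuples k L. us \<in> accepted_rel \<alpha> (alphabet \<A>) k (\<A>s ! i) \<longleftrightarrow> map h us \<in> R)"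
    if "i < length (rels \<M>)" for i
    using list_all2_nthD2[OF rels that] len that
    by (cases "rels \<M> ! i") (simp add: Rs_def L_def)
  have len_Rs: "length Rs = length (rels \<M>)" by (simp add: Rs_def len)
  have compat: "R' \<subseteq> tuples k L \<and> compatible E R'" if kR: "(k, R') \<in> set Rs" for k R'
  proof -
    obtain i where i: "i < length (rels \<M>)" "Rs ! i = (k, R')"
      using kR len_Rs by (auto simp: in_set_conv_nth)
    obtain R where R': "R' = accepted_rel \<alpha> (alphabet \<A>) k (\<A>s ! i)"
        and R: "\<And>us. us \<in> tuples k L \<Longrightarrow> us \<in> R' \<longleftrightarrow> map h us \<in> R"
      using nth[OF i(1)] i(2) by auto
    have sub: "R' \<subseteq> tuples k L" using accepted_subset R' by simp
    have "vs \<in> R'" if "list_all2 (\<lambda>u v. (u, v) \<in> E) us vs" "us \<in> R'" for us vs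
    proof -
      have "us \<in> tuples k L" using sub that(2) by blast
      moreover have "map h us = map h vs" "set vs \<subseteq> L" "length us = length vs"
        using that(1) by (induction rule: list_all2_induct) (auto simp: E_iff)
      ultimately show ?thesis using R[of us] R[of vs] that(2) by (simp add: tuples_def)
    qed
    then show ?thesis using sub by (auto simp: compatible_def)
  qed
  have iso: "is_isomorphism g (quotient_structure \<lparr>universe = L, rels = Rs\<rparr> E) \<M>"
    unfolding is_isomorphism_def
  proof
    have "inj_on g (L // E)"
      by (rule inj_onI) (auto elim!: quotientE simp: g inj E_iff)
    moreover have "g ` (L // E) = h ` L"
      by (auto simp: quotient_def g image_iff)
    ultimately show "bij_betw g (universe (quotient_structure \<lparr>universe = L, rels = Rs\<rparr> E)) (universe \<M>)"
      using h by (simp add: bij_betw_def quotient_structure_def L_def)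
    show "list_all2 (\<lambda>(k, R) (l, S). k = l \<and>
        (\<forall>xs \<in> tuples k (universe (quotient_structure \<lparr>universe = L, rels = Rs\<rparr> E)). xs \<in> R \<longleftrightarrow> map g xs \<in> S))
      (rels (quotient_structure \<lparr>universe = L, rels = Rs\<rparr> E)) (rels \<M>)"
    proof (rule list_all2_all_nthI)
      fix i assume "i < length (rels (quotient_structure \<lparr>universe = L, rels = Rs\<rparr> E))"
      then have i: "i < length (rels \<M>)" "i < length Rs"
        by (simp_all add: quotient_structure_def len_Rs)
      obtain k R R' where kR: "rels \<M> ! i = (k, R)" "Rs ! i = (k, R')"
          and sub: "R' \<subseteq> tuples k L" and R: "\<And>us. us \<in> tuples k L \<Longrightarrow> us \<in> R' \<longleftrightarrow> map h us \<in> R"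
        using nth[OF i(1)] accepted_subset by force
      have "xs \<in> map (\<lambda>u. E `` {u}) ` R' \<longleftrightarrow> map g xs \<in> R" if xs: "xs \<in> tuples k (L // E)" for xs
      proof -
        have "\<forall>x\<in>set xs. \<exists>u\<in>L. x = E `` {u}"
          using xs by (auto simp: tuples_def quotient_def)
        \<comment> \<open>Representatives lift a tuple of classes to a tuple of words, where the
          hypothesis on the relation applies.\<close>
        then obtain r where r: "\<And>x. x \<in> set xs \<Longrightarrow> r x \<in> L \<and> x = E `` {r x}" by metis
        define us where "us = map r xs"
        have us: "us \<in> tuples k L" using xs r by (auto simp: us_def tuples_def)
        have cls: "xs = map (\<lambda>u. E `` {u}) us"
          unfolding us_def map_map using r by (intro map_idI[symmetric]) simp
        have gxs: "map g xs = map h us"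
          unfolding us_def map_map using r g by (intro map_cong) (auto, metis)
        show ?thesis
        proof
          assume "xs \<in> map (\<lambda>u. E `` {u}) ` R'"
          then obtain vs where vs: "vs \<in> R'" "map (\<lambda>u. E `` {u}) vs = xs" by blast
          then have "vs \<in> tuples k L" using sub by blast
          then have "map h vs = map g xs"
            using g unfolding vs(2)[symmetric] by (auto simp: tuples_def)
          then show "map g xs \<in> R" using R[OF \<open>vs \<in> tuples k L\<close>] vs(1) by simp
        next
          assume "map g xs \<in> R"
          then have "us \<in> R'" using R[OF us] gxs by simp
          then show "xs \<in> map (\<lambda>u. E `` {u}) ` R'" using cls by blast
        qed
      qed
      then show "(case rels (quotient_structure \<lparr>universe = L, rels = Rs\<rparr> E) ! i of (k, R) \<Rightarrow>
          \<lambda>(l, S). k = l \<and> (\<forall>xs \<in> tuples k (universe (quotient_structure \<lparr>universe = L, rels = Rs\<rparr> E)).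
            xs \<in> R \<longleftrightarrow> map g xs \<in> S)) (rels \<M> ! i)"
        using i by (simp add: quotient_structure_def kR)
    qed (simp add: quotient_structure_def len_Rs)
  qed
  have "list_all2 (\<lambda>\<B> (k, R). ord_automaton \<B> \<and> alphabet \<B> = tuples k (alphabet \<A>)) \<A>s (rels \<M>)"
    using rels by (rule list_all2_mono) auto
  moreover have "\<forall>(k, R') \<in> set Rs. R' \<subseteq> tuples k L \<and> compatible E R'"
    using compat by blast
  moreover have "\<forall>u\<in>L. g (E `` {u}) = h u"
    using g by blast
  moreover have L: "L = lang \<alpha> \<A>" by (simp add: \<A>(2) L_def)
  moreover have "h ` L = universe \<M>" using h by (simp add: L_def)
  ultimately show ?thesis
    unfolding automatic_def using equiv iso unfolding L
    by (intro exI[of _ \<A>] exI[of _ \<A>eq] exI[of _ \<A>s] exI[of _ h] exI[of _ E] exI[of _ Rs]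
        exI[of _ g] conjI) (rule \<A> \<A>eq E_def Rs_def | assumption)+
qed

section \<open>The algebra modulo small sets\<close>

lemma small_sets_subset: "P \<in> small_sets n \<Longrightarrow> Q \<subseteq> P \<Longrightarrow> Q \<in> small_sets n"
  by (auto simp: small_sets_iff dest: full_type_mono)

lemma small_sets_Un: "P \<in> small_sets n \<Longrightarrow> Q \<in> small_sets n \<Longrightarrow> P \<union> Q \<in> small_sets n"
  by (auto simp: small_sets_iff dest: full_type_UnD)

text \<open>Transitivity holds because the small sets form an ideal and the symmetric difference of
  \<open>A\<close> and \<open>C\<close> lies in the union of those of \<open>A\<close>,
  \<open>B\<close> and of \<open>B\<close>, \<open>C\<close>.\<close>

lemma equiv_approx_rel: "equiv (Pow {..<omega_pow n}) (approx_rel n)"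
proof (rule equivI)
  show "approx_rel n \<subseteq> Pow {..<omega_pow n} \<times> Pow {..<omega_pow n}"
    by (auto simp: approx_rel_def)
  show "refl_on (Pow {..<omega_pow n}) (approx_rel n)"
    by (auto simp: approx_rel_def refl_on_def small_sets_iff full_type_empty)
  show "sym (approx_rel n)"
    by (auto simp: sym_def approx_rel_def Un_commute)
  show "trans (approx_rel n)"
  proof (rule transI)
    fix A B C assume *: "(A, B) \<in> approx_rel n" "(B, C) \<in> approx_rel n"
    then have "((A - B) \<union> (B - A)) \<union> ((B - C) \<union> (C - B)) \<in> small_sets n"
      by (intro small_sets_Un[of "(A - B) \<union> (B - A)"]) (simp_all add: approx_rel_def)
    then have "(A - C) \<union> (C - A) \<in> small_sets n"
      by (rule small_sets_subset) blast
    with * show "(A, C) \<in> approx_rel n" by (auto simp: approx_rel_def)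
  qed
qed

lemma approx_class_eq_iff:
  assumes "A \<subseteq> {..<omega_pow n}" "B \<subseteq> {..<omega_pow n}"
  shows "approx_class n A = approx_class n B \<longleftrightarrow> (A - B) \<union> (B - A) \<in> small_sets n"
  using eq_equiv_class_iff[OF equiv_approx_rel, of A n B] assms
  by (simp add: approx_class_def approx_rel_def)

text \<open>The symmetric difference of the results lies in the union of those of the arguments,
  which is small.\<close>

lemma approx_class_binop_cong:
  assumes "A \<subseteq> {..<omega_pow n}" "B \<subseteq> {..<omega_pow n}" "A' \<subseteq> {..<omega_pow n}" "B' \<subseteq> {..<omega_pow n}"
    and "approx_class n A = approx_class n A'" "approx_class n B = approx_class n B'"
  shows "approx_class n (A \<inter> B) = approx_class n (A' \<inter> B')"
    and "approx_class n (A \<union> B) = approx_class n (A' \<union> B')"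
proof -
  have *: "((A - A') \<union> (A' - A)) \<union> ((B - B') \<union> (B' - B)) \<in> small_sets n"
    using assms by (intro small_sets_Un[of "(A - A') \<union> (A' - A)"]) (simp_all add: approx_class_eq_iff)
  have "A \<inter> B \<subseteq> {..<omega_pow n}" "A' \<inter> B' \<subseteq> {..<omega_pow n}"
    using assms(1,3) by blast+
  moreover have "((A \<inter> B) - (A' \<inter> B')) \<union> ((A' \<inter> B') - (A \<inter> B)) \<in> small_sets n"
    by (rule small_sets_subset[OF *]) blast
  ultimately show "approx_class n (A \<inter> B) = approx_class n (A' \<inter> B')"
    by (simp add: approx_class_eq_iff)
  have "A \<union> B \<subseteq> {..<omega_pow n}" "A' \<union> B' \<subseteq> {..<omega_pow n}"
    using assms(1-4) by blast+
  moreover have "((A \<union> B) - (A' \<union> B')) \<union> ((A' \<union> B') - (A \<union> B)) \<in> small_sets n"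
    by (rule small_sets_subset[OF *]) blast
  ultimately show "approx_class n (A \<union> B) = approx_class n (A' \<union> B')"
    by (simp add: approx_class_eq_iff)
qed

lemma approx_class_Compl_cong:
  assumes "A \<subseteq> {..<omega_pow n}" "A' \<subseteq> {..<omega_pow n}" "approx_class n A = approx_class n A'"
  shows "approx_class n ({..<omega_pow n} - A) = approx_class n ({..<omega_pow n} - A')"
proof -
  have "(({..<omega_pow n} - A) - ({..<omega_pow n} - A')) \<union> (({..<omega_pow n} - A') - ({..<omega_pow n} - A)) =
      (A - A') \<union> (A' - A)"
    using assms(1,2) by blast
  then show ?thesis using assms by (simp add: approx_class_eq_iff)
qed

text \<open>The only final state \<open>2 * n\<close> has fullness bit 0. Thus every letterwise
  property \<phi> of tuples yields a recognisable smallness test.\<close>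

lemma accepted_rel_block_automaton_iff:
  assumes us: "us \<in> tuples k (words (omega_pow n) S)"
  shows "us \<in> accepted_rel (omega_pow n) S k (block_automaton (tuples k S) n \<phi> {2 * n}) \<longleftrightarrow>
    {i \<in> {..<omega_pow n}. \<phi> (map (\<lambda>w. w i) us)} \<in> small_sets n"
proof -
  let ?c = "convolution (omega_pow n) us"
  have "w i \<in> S" if "w \<in> set us" "i < omega_pow n" for w i
    using us that by (auto simp: tuples_def words_def)
  then have "?c \<in> words (omega_pow n) (tuples k S)"
    using us by (auto simp: convolution_def words_def tuples_def)
  \<comment> \<open>Outside \<open>\<omega>^n\<close> the convolution takes the value
    \<open>undefined\<close>; \<open>full_type_cong\<close> disregards those positions.\<close>
  moreover have "full_type n {i. \<phi> (?c i)} \<longleftrightarrow> full_type n {i \<in> {..<omega_pow n}. \<phi> (map (\<lambda>w. w i) us)}"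
    by (rule full_type_cong) (simp add: convolution_def omega_pow_def)
  ultimately show ?thesis using us
    by (auto simp: accepted_rel_def lang_block_automaton[of n, folded omega_pow_def] small_sets_iff)
qed

lemma finite_tuples: "finite S \<Longrightarrow> finite (tuples k S)"
  using finite_lists_length_eq[of S k] by (simp add: tuples_def conj_commute)

section \<open>Binary words as codes of subsets, and graphs on classes\<close>

definition ones :: "nat \<Rightarrow> (nat multiset \<Rightarrow> nat) \<Rightarrow> nat multiset set" where
  "ones n w = {i \<in> {..<omega_pow n}. w i = 1}"

lemma ones_subset: "ones n w \<subseteq> {..<omega_pow n}"
  by (auto simp: ones_def)

lemma ones_image_words: "ones n ` words (omega_pow n) {0, 1} = Pow {..<omega_pow n}"
proof (intro subset_antisym subsetI)
  fix A assume "A \<in> Pow {..<omega_pow n}"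
  then have "ones n (\<lambda>i\<in>{..<omega_pow n}. of_bool (i \<in> A)) = A"
    by (auto simp: ones_def)
  moreover have "(\<lambda>i\<in>{..<omega_pow n}. of_bool (i \<in> A)) \<in> words (omega_pow n) {0, 1}"
    by (auto simp: words_def)
  ultimately show "A \<in> ones n ` words (omega_pow n) {0, 1}" by (metis imageI)
qed (auto simp: ones_def)

text \<open>The graph ranges over arbitrary representatives. By the congruence they may be exchanged
  for the given \<open>A\<close> and \<open>B\<close>, leaving one equation for the last
  entry.\<close>

lemma binary_graph_quotient_iff:
  assumes "A \<subseteq> U" "B \<subseteq> U"
    and cong: "\<And>A' B'. A' \<subseteq> U \<Longrightarrow> B' \<subseteq> U \<Longrightarrow> f A = f A' \<Longrightarrow> f B = f B' \<Longrightarrow> f (g A B) = f (g A' B')"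
  shows "[f A, f B, c] \<in> {[f A, f B, f (g A B)] | A B. A \<subseteq> U \<and> B \<subseteq> U} \<longleftrightarrow> c = f (g A B)"
proof
  assume "[f A, f B, c] \<in> {[f A, f B, f (g A B)] | A B. A \<subseteq> U \<and> B \<subseteq> U}"
  then obtain A' B' where "A' \<subseteq> U" "B' \<subseteq> U" "f A = f A'" "f B = f B'" "c = f (g A' B')"
    by blast
  then show "c = f (g A B)" using cong by metis
qed (use assms in blast)

lemma unary_graph_quotient_iff:
  assumes "A \<subseteq> U" and cong: "\<And>A'. A' \<subseteq> U \<Longrightarrow> f A = f A' \<Longrightarrow> f (g A) = f (g A')"
  shows "[f A, c] \<in> {[f A, f (g A)] | A. A \<subseteq> U} \<longleftrightarrow> c = f (g A)"
proof
  assume "[f A, c] \<in> {[f A, f (g A)] | A. A \<subseteq> U}"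
  then obtain A' where "A' \<subseteq> U" "f A = f A'" "c = f (g A')"
    by blast
  then show "c = f (g A)" using cong by metis
qed (use assms in blast)

theorem theorem4p2:
  fixes n :: nat
  assumes "n \<ge> 1"
  shows "automatic (omega_pow n) (pow_omega_algebra n)"
proof -
  let ?\<alpha> = "omega_pow n" and ?S = "{0, 1::nat}"
  let ?aut = "\<lambda>k \<phi>. block_automaton (tuples k ?S) n \<phi> {2 * n}"
  let ?W = "words ?\<alpha> ?S"
  \<comment> \<open>Each predicate marks the positions at which the last coordinate differs from the
    prescribed result: the other word for \<open>?eq\<close>, the operation applied to the earlier
    coordinates, or a constant.\<close>
  let ?eq = "\<lambda>as. (as ! 0 = 1) \<noteq> (as ! 1 = 1)"
    and ?int = "\<lambda>as. (as ! 2 = 1) \<noteq> (as ! 0 = 1 \<and> as ! 1 = 1)"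
    and ?un = "\<lambda>as. (as ! 2 = 1) \<noteq> (as ! 0 = 1 \<or> as ! 1 = 1)"
    and ?neg = "\<lambda>as. (as ! 1 = 1) \<noteq> (as ! 0 \<noteq> 1)"
    and ?zero = "\<lambda>as. as ! 0 = 1" and ?one = "\<lambda>as. as ! 0 \<noteq> 1"
  \<comment> \<open>Every state is final, so all binary words are codes.\<close>
  define \<A> where "\<A> = block_automaton ?S n (\<lambda>_. True) {..2 * n + 1}"
  define h where "h w = approx_class n (ones n w)" for w
  have alph: "alphabet (block_automaton T n \<phi> F) = T" for T :: "'x set" and \<phi> F
    by (simp add: block_automaton_def)
  have aut: "ord_automaton (?aut k \<phi>)" for k \<phi>
    by (rule ord_automaton_block_automaton) (simp_all add: finite_tuples)
  have alph\<A>: "alphabet \<A> = ?S" by (simp add: \<A>_def alph)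
  \<comment> \<open>These identities turn the marked positions into symmetric differences of coded
    sets, whose smallness is equality of classes.\<close>
  have diff: "{i \<in> {..<?\<alpha>}. (u i = 1) \<noteq> (v i = 1)} = (ones n u - ones n v) \<union> (ones n v - ones n u)" for u v
    by (auto simp: ones_def)
  have diff_int: "{i \<in> {..<?\<alpha>}. (w i = 1) \<noteq> (u i = 1 \<and> v i = 1)} =
      (ones n w - ones n u \<inter> ones n v) \<union> (ones n u \<inter> ones n v - ones n w)" for u v w
    by (auto simp: ones_def)
  have diff_un: "{i \<in> {..<?\<alpha>}. (w i = 1) \<noteq> (u i = 1 \<or> v i = 1)} =
      (ones n w - (ones n u \<union> ones n v)) \<union> (ones n u \<union> ones n v - ones n w)" for u v w
    by (auto simp: ones_def)
  have diff_neg: "{i \<in> {..<?\<alpha>}. (w i = 1) \<noteq> (u i \<noteq> 1)} =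
      (ones n w - ({..<?\<alpha>} - ones n u)) \<union> ({..<?\<alpha>} - ones n u - ones n w)" for u w
    by (auto simp: ones_def)
  have int: "us \<in> accepted_rel ?\<alpha> ?S 3 (?aut 3 ?int) \<longleftrightarrow> map h us \<in>
      {[approx_class n A, approx_class n B, approx_class n (A \<inter> B)] | A B.
        A \<subseteq> {..<?\<alpha>} \<and> B \<subseteq> {..<?\<alpha>}}" if us: "us \<in> tuples 3 ?W" for us
  proof -
    obtain u v w where eq: "us = [u, v, w]"
      using us by (auto simp: tuples_def length_Suc_conv eval_nat_numeral)
    have "us \<in> accepted_rel ?\<alpha> ?S 3 (?aut 3 ?int) \<longleftrightarrow>
        (ones n w - (ones n u \<inter> ones n v)) \<union> (ones n u \<inter> ones n v - ones n w) \<in> small_sets n"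
      unfolding accepted_rel_block_automaton_iff[OF us] diff_int[symmetric] by (simp add: eq)
    also have "\<dots> \<longleftrightarrow> h w = approx_class n (ones n u \<inter> ones n v)"
      unfolding h_def by (rule approx_class_eq_iff[symmetric]) (use ones_subset in blast)+
    also have "\<dots> \<longleftrightarrow> [approx_class n (ones n u), approx_class n (ones n v), h w] \<in>
        {[approx_class n A, approx_class n B, approx_class n (A \<inter> B)] | A B.
          A \<subseteq> {..<?\<alpha>} \<and> B \<subseteq> {..<?\<alpha>}}"
      by (rule binary_graph_quotient_iff[symmetric, OF ones_subset ones_subset])
        (rule approx_class_binop_cong(1)[OF ones_subset ones_subset])
    finally show ?thesis by (simp only: eq list.map h_def)
  qed
  have un: "us \<in> accepted_rel ?\<alpha> ?S 3 (?aut 3 ?un) \<longleftrightarrow> map h us \<in>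
      {[approx_class n A, approx_class n B, approx_class n (A \<union> B)] | A B.
        A \<subseteq> {..<?\<alpha>} \<and> B \<subseteq> {..<?\<alpha>}}" if us: "us \<in> tuples 3 ?W" for us
  proof -
    obtain u v w where eq: "us = [u, v, w]"
      using us by (auto simp: tuples_def length_Suc_conv eval_nat_numeral)
    have "us \<in> accepted_rel ?\<alpha> ?S 3 (?aut 3 ?un) \<longleftrightarrow>
        (ones n w - (ones n u \<union> ones n v)) \<union> (ones n u \<union> ones n v - ones n w) \<in> small_sets n"
      unfolding accepted_rel_block_automaton_iff[OF us] diff_un[symmetric] by (simp add: eq)
    also have "\<dots> \<longleftrightarrow> h w = approx_class n (ones n u \<union> ones n v)"
      unfolding h_def by (rule approx_class_eq_iff[symmetric]) (use ones_subset in blast)+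
    also have "\<dots> \<longleftrightarrow> [approx_class n (ones n u), approx_class n (ones n v), h w] \<in>
        {[approx_class n A, approx_class n B, approx_class n (A \<union> B)] | A B.
          A \<subseteq> {..<?\<alpha>} \<and> B \<subseteq> {..<?\<alpha>}}"
      by (rule binary_graph_quotient_iff[symmetric, OF ones_subset ones_subset])
        (rule approx_class_binop_cong(2)[OF ones_subset ones_subset])
    finally show ?thesis by (simp only: eq list.map h_def)
  qed
  have neg: "us \<in> accepted_rel ?\<alpha> ?S 2 (?aut 2 ?neg) \<longleftrightarrow> map h us \<in>
      {[approx_class n A, approx_class n ({..<?\<alpha>} - A)] | A. A \<subseteq> {..<?\<alpha>}}"
    if us: "us \<in> tuples 2 ?W" for us
  proof -
    obtain u w where eq: "us = [u, w]"
      using us by (auto simp: tuples_def length_Suc_conv eval_nat_numeral)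
    have "us \<in> accepted_rel ?\<alpha> ?S 2 (?aut 2 ?neg) \<longleftrightarrow>
        (ones n w - ({..<?\<alpha>} - ones n u)) \<union> ({..<?\<alpha>} - ones n u - ones n w) \<in> small_sets n"
      unfolding accepted_rel_block_automaton_iff[OF us] diff_neg[symmetric] by (simp add: eq)
    also have "\<dots> \<longleftrightarrow> h w = approx_class n ({..<?\<alpha>} - ones n u)"
      unfolding h_def by (rule approx_class_eq_iff[symmetric]) (use ones_subset in blast)+
    also have "\<dots> \<longleftrightarrow> [approx_class n (ones n u), h w] \<in>
        {[approx_class n A, approx_class n ({..<?\<alpha>} - A)] | A. A \<subseteq> {..<?\<alpha>}}"
      by (rule unary_graph_quotient_iff[symmetric, OF ones_subset])
        (rule approx_class_Compl_cong[OF ones_subset])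
    finally show ?thesis by (simp only: eq list.map h_def)
  qed
  have zero: "us \<in> accepted_rel ?\<alpha> ?S 1 (?aut 1 ?zero) \<longleftrightarrow> map h us \<in> {[approx_class n {}]}"
    if us: "us \<in> tuples 1 ?W" for us
  proof -
    obtain u where [simp]: "us = [u]"
      using us by (auto simp: tuples_def length_Suc_conv)
    have "{i \<in> {..<?\<alpha>}. u i = 1} = (ones n u - {}) \<union> ({} - ones n u)" by (auto simp: ones_def)
    then show ?thesis
      unfolding accepted_rel_block_automaton_iff[OF us]
      using approx_class_eq_iff[OF ones_subset empty_subsetI, of n u] by (simp add: h_def)
  qed
  have one: "us \<in> accepted_rel ?\<alpha> ?S 1 (?aut 1 ?one) \<longleftrightarrow> map h us \<in> {[approx_class n {..<?\<alpha>}]}"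
    if us: "us \<in> tuples 1 ?W" for us
  proof -
    obtain u where [simp]: "us = [u]"
      using us by (auto simp: tuples_def length_Suc_conv)
    have "{i \<in> {..<?\<alpha>}. u i \<noteq> 1} = (ones n u - {..<?\<alpha>}) \<union> ({..<?\<alpha>} - ones n u)" by (auto simp: ones_def)
    then show ?thesis
      unfolding accepted_rel_block_automaton_iff[OF us]
      using approx_class_eq_iff[OF ones_subset order_refl, of n u] by (simp add: h_def)
  qed
  show ?thesis
  proof (rule automaticI[where \<A> = \<A> and \<A>eq = "?aut 2 ?eq" and h = h
        and \<A>s = "[?aut 3 ?int, ?aut 3 ?un, ?aut 2 ?neg, ?aut 1 ?zero, ?aut 1 ?one]"])
    show "ord_automaton \<A>"
      unfolding \<A>_def by (rule ord_automaton_block_automaton) simp_all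
    show "lang ?\<alpha> \<A> = words ?\<alpha> (alphabet \<A>)"
      by (auto simp: \<A>_def alph lang_block_automaton[of n, folded omega_pow_def])
    show "ord_automaton (?aut 2 ?eq)" by (rule aut)
    show "alphabet (?aut 2 ?eq) = tuples 2 (alphabet \<A>)" by (simp add: alph alph\<A>)
    have "h ` ?W = approx_class n ` ones n ` ?W"
      by (simp add: h_def image_image)
    also have "\<dots> = universe (pow_omega_algebra n)"
      unfolding ones_image_words by (auto simp: pow_omega_algebra_def quotient_def approx_class_def)
    finally show "h ` words ?\<alpha> (alphabet \<A>) = universe (pow_omega_algebra n)"
      by (simp add: alph\<A>)
    show "[u, v] \<in> accepted_rel ?\<alpha> (alphabet \<A>) 2 (?aut 2 ?eq) \<longleftrightarrow> h u = h v"
      if "u \<in> words ?\<alpha> (alphabet \<A>)" "v \<in> words ?\<alpha> (alphabet \<A>)" for u v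
    proof -
      have uv: "[u, v] \<in> tuples 2 ?W" using that by (simp add: tuples_def alph\<A>)
      show ?thesis
        unfolding alph\<A> accepted_rel_block_automaton_iff[OF uv] h_def
          approx_class_eq_iff[OF ones_subset ones_subset] diff[symmetric]
        by simp
    qed
    show "list_all2 (\<lambda>\<B> (k, R). ord_automaton \<B> \<and> alphabet \<B> = tuples k (alphabet \<A>) \<and>
        (\<forall>us \<in> tuples k (words ?\<alpha> (alphabet \<A>)).
          us \<in> accepted_rel ?\<alpha> (alphabet \<A>) k \<B> \<longleftrightarrow> map h us \<in> R))
      [?aut 3 ?int, ?aut 3 ?un, ?aut 2 ?neg, ?aut 1 ?zero, ?aut 1 ?one] (rels (pow_omega_algebra n))"
      unfolding pow_omega_algebra_def rel_structure.simps list_all2_Cons list_all2_Nil prod.case alph\<A> alph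
      by (intro conjI ballI aut int un neg zero one refl TrueI)
  qed
qed

end
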